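(* Let $G$ be a cyclic group of prime order $|G|=p\ge3$. Then $\Delta(\mathcal B_\pm(G))=[1,p-2]$ and $$2+\max\Delta\bigl(\mathcal B_\pm(G)\bigr)=\mathsf c\bigl(\mathcal B_\pm(G)\bigr)=\omega\bigl(\mathcal B_\pm(G)\bigr)=\mathsf D_\pm(G).$$
   Context: Intervals are discrete: $[a,b]=\{x\in\mathbb Z:a\le x\le b\}$. $\mathcal F(G)$ is the (multiplicative) free abelian monoid with basis $G$ and $|S|$ the length of $S\in\mathcal F(G)$. $\mathcal B_\pm(G)=\{g_1\cdot\ldots\cdot g_\ell\in\mathcal F(G):\ \ell\ge0,\ \varepsilon_1g_1+\dots+\varepsilon_\ell g_\ell=0\text{ for some }\varepsilon_i\in\{1,-1\}\}$. $\mathsf D_\pm(G)$ is the maximal length $|U|$ of an atom $U$ of the monoid $\mathcal B_\pm(G)$. Let $H$ be a reduced atomic (commutative cancellative) monoid with set of atoms $\mathcal A(H)$ in which every element has only finitely many factorization lengths. $\mathsf L(a)$ is the set of all $k\in\mathbb N_0$ such that $a\in H$ is a product of $k$ atoms; $\mathcal L(H)=\{\mathsf L(a):a\in H\}$. For $L\subset\mathbb Z$, $\Delta(L)$ is the set of all $d\in\mathbb N$ for which there is $a\in L$ with $L\cap[a,a+d]=\{a,a+d\}$; $\Delta(H)=\bigcup_{L\in\mathcal L(H)}\Delta(L)$. $\mathsf Z(a)$ is the set of factorizations of $a$, i.e. of elements $z$ of the free abelian monoid with basis $\mathcal A(H)$ whose product in $H$ is $a$; the distance of two factorizations is $\mathsf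 d(z,z')=\max\{|z\gcd(z,z')^{-1}|,|z'\gcd(z,z')^{-1}|\}$. $\mathsf c(a)$ is the smallest $N\in\mathbb N_0\cup\{\infty\}$ such that any $z,z'\in\mathsf Z(a)$ can be joined by a finite sequence $z=z_0,\dots,z_k=z'$ in $\mathsf Z(a)$ with $\mathsf d(z_{i-1},z_i)\le N$ for all $i$; the catenary degree is $\mathsf c(H)=\sup\{\mathsf c(a):a\in H\}$. $\omega(H,a)$ is the smallest $N\in\mathbb N_0\cup\{\infty\}$ such that for all $n\in\mathbb N$ and $a_1,\dots,a_n\in H$ with $a\mid a_1\cdots a_n$ in $H$ there is $\Omega\subset[1,n]$ with $|\Omega|\le N$ and $a\mid\prod_{\lambda\in\Omega}a_\lambda$ in $H$; $\omega(H)=\sup\{\omega(H,u):u\in\mathcal A(H)\}$. *)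

theory Defs
  imports "HOL-Algebra.Algebra" "HOL-Library.Multiset" "HOL-Library.Extended_Nat"
begin

text \<open>
  A sequence over a group is a multiset over its carrier. Groups are written multiplicatively, so
  a signed sum \<open>\<epsilon>\<^sub>1 g\<^sub>1 + \<dots> + \<epsilon>\<^sub>l g\<^sub>l = 0\<close> becomes a product of powers equal to \<open>\<one>\<close>.
\<close>

definition plus_minus_monoid :: "('a, 'b) monoid_scheme \<Rightarrow> 'a multiset monoid"
  where "plus_minus_monoid G =
    \<lparr>carrier = {mset gs | gs. set gs \<subseteq> carrier G \<and>
       (\<exists>\<epsilon> :: nat \<Rightarrow> int. (\<forall>i<length gs. \<epsilon> i \<in> {1, -1}) \<and>
          (\<Otimes>\<^bsub>G\<^esub>i\<in>{..<length gs}. (gs ! i) [^]\<^bsub>G\<^esub> \<epsilon> i) = \<one>\<^bsub>G\<^esub>)},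
     monoid.mult = (+), one = {#}\<rparr>"

text \<open>
  The invariants below are meant for reduced commutative cancellative monoids. There,
  \<^const>\<open>Divisibility.irreducible\<close> (no proper divisor besides the unit) says that an element is
  an atom, and, as \<open>\<one>\<close> is the only unit, \<^const>\<open>factors\<close> describes products of atoms
  on the nose, including the empty product for \<open>\<one>\<close>.
\<close>

definition atoms :: "('a, 'b) monoid_scheme \<Rightarrow> 'a set"
  where "atoms H = {u \<in> carrier H. Divisibility.irreducible H u}"

definition factorizations :: "('a, 'b) monoid_scheme \<Rightarrow> 'a \<Rightarrow> 'a multiset set"
  where "factorizations H a = {mset us | us. set us \<subseteq> carrier H \<and> factors H us a}"

definition length_set :: "('a, 'b) monoid_scheme \<Rightarrow> 'a \<Rightarrow> nat set"
  where "length_set H a = {length us | us. set us \<subseteq> carrier H \<and> factors H us a}"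

definition system_of_length_sets :: "('a, 'b) monoid_scheme \<Rightarrow> nat set set"
  where "system_of_length_sets H = length_set H ` carrier H"

definition delta_set :: "int set \<Rightarrow> nat set"
  where "delta_set L = {d. d \<ge> 1 \<and> (\<exists>a\<in>L. L \<inter> {a..a + int d} = {a, a + int d})}"

definition delta_monoid :: "('a, 'b) monoid_scheme \<Rightarrow> nat set"
  where "delta_monoid H = (\<Union>L\<in>system_of_length_sets H. delta_set (int ` L))"

text \<open>The gcd of two elements of a free abelian monoid is the multiset intersection.\<close>

definition factorization_dist :: "'a multiset \<Rightarrow> 'a multiset \<Rightarrow> nat"
  where "factorization_dist z z' = max (size (z - z \<inter># z')) (size (z' - z \<inter># z'))"

definition catenary_degree_elem :: "('a, 'b) monoid_scheme \<Rightarrow> 'a \<Rightarrow> enat"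
  where "catenary_degree_elem H a = (LEAST N.
    \<forall>z\<in>factorizations H a. \<forall>z'\<in>factorizations H a.
      (z, z') \<in> {(x, y). x \<in> factorizations H a \<and> y \<in> factorizations H a \<and>
                         enat (factorization_dist x y) \<le> N}\<^sup>*)"

definition catenary_degree :: "('a, 'b) monoid_scheme \<Rightarrow> enat"
  where "catenary_degree H = (SUP a\<in>carrier H. catenary_degree_elem H a)"

definition omega_elem :: "('a, 'b) monoid_scheme \<Rightarrow> 'a \<Rightarrow> enat"
  where "omega_elem H a = (LEAST N.
    \<forall>n\<ge>1. \<forall>b \<in> {1..n::nat} \<rightarrow> carrier H.
      a divides\<^bsub>H\<^esub> (\<Otimes>\<^bsub>H\<^esub>i\<in>{1..n}. b i) \<longrightarrow>
      (\<exists>\<Omega>\<subseteq>{1..n}. enat (card \<Omega>) \<le> N \<and> a divides\<^bsub>H\<^esub> (\<Otimes>\<^bsub>H\<^esub>i\<in>\<Omega>. b i)))"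

definition omega_monoid :: "('a, 'b) monoid_scheme \<Rightarrow> enat"
  where "omega_monoid H = (SUP u\<in>atoms H. omega_elem H u)"

text \<open>
  The maximum exists for every finite abelian group, which is the only case this is meant for;
  \<^const>\<open>Max\<close> is unspecified on infinite sets.
\<close>

definition plus_minus_Davenport :: "('a, 'b) monoid_scheme \<Rightarrow> nat"
  where "plus_minus_Davenport G = Max (size ` atoms (plus_minus_monoid G))"

end

theory Submission
  imports Defs "HOL-Number_Theory.Cong"
begin

text \<open>
  Write \<open>H\<close> for the monoid of plus-minus weighted zero-sum sequences over a cyclic group of odd
  prime order \<open>p\<close>. Everything follows from the chain
  \<open>p = 2 + (p - 2) \<le> 2 + max \<Delta>(H) \<le> c(H) \<le> \<omega>(H) \<le> p\<close>.

  The two inequalities in the middle hold in every monoid of multisets. If a chain of factorizations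
  jumps over a gap \<open>d\<close> between two lengths, the two factorizations at the jump have distance at least
  \<open>d + 2\<close>, because after cancelling common atoms even the shorter one keeps two atoms
  (\<open>delta_le_catenary_degree\<close>). And an atom of one factorization divides a product of at most
  \<open>\<omega>(H)\<close> atoms of the other, which allows a long factorization to be rewritten by an induction on
  the element until it has an atom in common with the other (\<open>catenary_degree_le_omega\<close>).

  The upper bound rests on an instance of the Cauchy--Davenport inequality: the signed sums of any
  \<open>p - 1\<close> nonzero elements exhaust the group, so every sequence with that many nonzero elements lies
  in \<open>H\<close> (\<open>zero_sums_of_many_nonzero\<close>). Hence atoms have length at most \<open>p\<close>. Moreover, if an atom
  \<open>u\<close> divides a product of elements, \<open>p\<close> factors with nonzero elements that together contain \<open>u\<close>
  have at least \<open>2 p\<close> nonzero elements, so that the complement of \<open>u\<close> keeps \<open>p\<close> of them and lies in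
  \<open>H\<close>; this gives \<open>\<omega>(H) \<le> p\<close> (\<open>omega_monoid_le_p\<close>).

  The lower bound comes from explicit lengths. For a generator \<open>g\<close>, \<open>2 \<le> a \<le> p - 1\<close> and \<open>h\<close> the
  \<open>a\<close>-fold of \<open>g\<close>, the sequence \<open>g\<^sup>p\<^sup>+\<^sup>a h\<close> has exactly the factorizations
  \<open>(g\<^sup>a h) (g\<^sup>p)\<close> and \<open>(g\<^sup>p\<^sup>-\<^sup>a h) (g\<^sup>2)\<^sup>a\<close>, so its set of lengths is \<open>{2, a + 1}\<close> and \<open>a - 1\<close> is a gap
  (\<open>length_set_two_values\<close>). This realizes all gaps from \<open>1\<close> to \<open>p - 2\<close>, and larger gaps are excluded
  by \<open>c(H) \<le> p\<close>. Finally, the atom \<open>g\<^sup>p\<close> attains the Davenport constant \<open>p\<close>.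
\<close>

section \<open>Multisets\<close>

lemma replicate_mset_add: "replicate_mset (m + n) x = replicate_mset m x + replicate_mset n x"
  by (induction m) auto

lemma sum_mset_replicate_mset: "\<Sum>\<^sub># (replicate_mset k (replicate_mset m x)) = replicate_mset (k * m) x"
  by (induction k) (simp_all add: replicate_mset_add)

lemma mem_sum_multisets:
  fixes b :: "'i \<Rightarrow> 'c multiset"
  shows "x \<in># sum b I \<Longrightarrow> \<exists>i\<in>I. x \<in># b i"
  by (induction I rule: infinite_finite_induct) auto

text \<open>Each element of \<open>u\<close>, counted with multiplicity, requires at most one further index.\<close>

lemma subseteq_sum_cover:
  fixes b :: "'i \<Rightarrow> 'c multiset"
  assumes "finite I" "u \<subseteq># sum b I"
  shows "\<exists>J\<subseteq>I. card J \<le> size u \<and> u \<subseteq># sum b J"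
  using assms(2)
proof (induction u)
  case empty
  then show ?case by (intro exI[of _ "{}"]) auto
next
  case (add x u)
  then obtain J where J: "J \<subseteq> I" "card J \<le> size u" "u \<subseteq># sum b J"
    by (metis add_mset_add_single mset_subset_eq_add_left subset_mset.order_trans)
  have fJ: "finite J"
    using J(1) assms(1) finite_subset by blast
  show ?case
  proof (cases "add_mset x u \<subseteq># sum b J")
    case True
    then show ?thesis using J by (intro exI[of _ J]) auto
  next
    case False
    have "count (sum b J) x < count (sum b I) x"
    proof -
      have "\<exists>y. count (add_mset x u) y > count (sum b J) y"
        using False by (auto simp: subseteq_mset_def not_le)
      then have "count (add_mset x u) x > count (sum b J) x"
        using J(3) by (metis count_add_mset mset_subset_eq_count not_le)
      also have "count (add_mset x u) x \<le> count (sum b I) x"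
        using add.prems by (rule mset_subset_eq_count)
      finally show ?thesis .
    qed
    moreover have "sum b I = sum b J + sum b (I - J)"
      using assms(1) J(1) by (metis add.commute sum.subset_diff)
    ultimately have "count (sum b (I - J)) x > 0"
      by simp
    then obtain i where i: "i \<in> I - J" "x \<in># b i"
      using mem_sum_multisets count_greater_zero_iff by metis
    have "{#x#} + u \<subseteq># b i + sum b J"
      using i(2) J(3) by (intro subset_mset.add_mono) auto
    then show ?thesis
      using i J fJ by (intro exI[of _ "insert i J"]) auto
  qed
qed

section \<open>Monoids of multisets\<close>

locale multiset_monoid =
  fixes M :: "'a multiset set"
  assumes empty_mem [simp]: "{#} \<in> M"
    and add_mem: "\<And>a b. a \<in> M \<Longrightarrow> b \<in> M \<Longrightarrow> a + b \<in> M"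
begin

abbreviation H :: "'a multiset monoid"
  where "H \<equiv> \<lparr>carrier = M, monoid.mult = (+), one = {#}\<rparr>"

lemma comm_monoid_H: "comm_monoid H"
  by (rule comm_monoidI) (auto simp: add_mem ac_simps)

lemma sum_mset_mem: "set_mset z \<subseteq> M \<Longrightarrow> \<Sum>\<^sub># z \<in> M"
  by (induction z) (auto simp: add_mem)

lemma sum_mem: "(\<And>i. i \<in> I \<Longrightarrow> b i \<in> M) \<Longrightarrow> sum b I \<in> M"
  by (induction I rule: infinite_finite_induct) (auto simp: add_mem)

lemma finprod_H: "finite I \<Longrightarrow> b \<in> I \<rightarrow> M \<Longrightarrow> (\<Otimes>\<^bsub>H\<^esub>i\<in>I. b i) = sum b I"
proof (induction I rule: finite_induct)
  case empty
  then show ?case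
    using comm_monoid.finprod_empty[OF comm_monoid_H] by simp
next
  case (insert i I)
  then show ?case
    using comm_monoid.finprod_insert[OF comm_monoid_H insert.hyps(1,2), of b] by auto
qed

lemma divides_H: "a divides\<^bsub>H\<^esub> b \<longleftrightarrow> (\<exists>c\<in>M. b = a + c)"
  by (simp add: factor_def)

lemma Units_H: "Units H = {{#}}"
  by (auto simp: Units_def)

lemma atoms_H:
  "u \<in> atoms H \<longleftrightarrow>
     u \<in> M \<and> u \<noteq> {#} \<and> (\<forall>b\<in>M. \<forall>c\<in>M. u = b + c \<longrightarrow> b = {#} \<or> c = {#})"
proof -
  have "properfactor H b u \<longleftrightarrow> (\<exists>c\<in>M. u = b + c \<and> c \<noteq> {#})" for b
  proof
    assume "properfactor H b u"
    then show "\<exists>c\<in>M. u = b + c \<and> c \<noteq> {#}"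
      by (auto simp: properfactor_def divides_H)
  next
    assume "\<exists>c\<in>M. u = b + c \<and> c \<noteq> {#}"
    then show "properfactor H b u"
      by (auto simp: properfactor_def divides_H add.assoc)
  qed
  then show ?thesis
    unfolding atoms_def Divisibility.irreducible_def Units_H by auto
qed

lemma atom_mem: "u \<in> atoms H \<Longrightarrow> u \<in> M"
  and atom_nonempty: "u \<in> atoms H \<Longrightarrow> u \<noteq> {#}"
  and atom_indecomposable:
    "u \<in> atoms H \<Longrightarrow> u = b + c \<Longrightarrow> b \<in> M \<Longrightarrow> c \<in> M \<Longrightarrow> b = {#} \<or> c = {#}"
  by (auto simp: atoms_H)

lemma sum_atoms_mem: "set_mset z \<subseteq> atoms H \<Longrightarrow> \<Sum>\<^sub># z \<in> M"
  using sum_mset_mem atom_mem by blast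

lemma factors_H_iff:
  "set us \<subseteq> carrier H \<and> factors H us a \<longleftrightarrow> set us \<subseteq> atoms H \<and> \<Sum>\<^sub># (mset us) = a"
proof -
  have "foldr (\<otimes>\<^bsub>H\<^esub>) us \<one>\<^bsub>H\<^esub> = \<Sum>\<^sub># (mset us)"
    by (induction us) auto
  then show ?thesis
    by (auto simp: factors_def atoms_def)
qed

lemma factorizations_H: "factorizations H a = {z. set_mset z \<subseteq> atoms H \<and> \<Sum>\<^sub># z = a}"
  unfolding factorizations_def factors_H_iff
  by (auto, metis ex_mset set_mset_mset)

lemma length_set_H: "length_set H a = size ` factorizations H a"
  unfolding length_set_def factorizations_def by (auto simp: image_iff) (metis size_mset)

lemma ex_factorization: "a \<in> M \<Longrightarrow> factorizations H a \<noteq> {}"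
proof (induction "size a" arbitrary: a rule: less_induct)
  case less
  show ?case
  proof (cases "a = {#} \<or> a \<in> atoms H")
    case True
    then have "{#} \<in> factorizations H a \<or> {#a#} \<in> factorizations H a"
      by (auto simp: factorizations_H)
    then show ?thesis by blast
  next
    case False
    with less.prems obtain b c where bc: "b \<in> M" "c \<in> M" "a = b + c" "b \<noteq> {#}" "c \<noteq> {#}"
      by (auto simp: atoms_H)
    then have "size b < size a" "size c < size a"
      by (auto simp: nonempty_has_size)
    with less.hyps bc obtain z z' where "z \<in> factorizations H b" "z' \<in> factorizations H c"
      by blast
    then have "z + z' \<in> factorizations H a"
      using bc by (auto simp: factorizations_H)
    then show ?thesis by blast
  qed
qed

section \<open>Distances of factorizations and gaps between lengths\<close>

lemma factorization_dist_commute: "factorization_dist x y = factorization_dist y x"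
  unfolding factorization_dist_def by (simp only: max.commute subset_mset.inf.commute)

text \<open>
  After cancelling the common part, the shorter factorization still has at least two atoms, since
  an atom is not a product of several atoms. This is where the summand 2 in \<open>2 + max \<Delta>\<close> comes from.
\<close>

lemma factorization_dist_lower_bound:
  assumes "x \<in> factorizations H a" "y \<in> factorizations H a" "size x < size y"
  shows "size y + 2 \<le> factorization_dist x y + size x"
proof -
  define g where "g = x \<inter># y"
  define x' where "x' = x - g"
  define y' where "y' = y - g"
  have xy: "x = g + x'" "y = g + y'"
    by (auto simp: x'_def y'_def g_def multiset_eq_iff)
  have at: "set_mset x' \<subseteq> atoms H" "set_mset y' \<subseteq> atoms H" and eq: "\<Sum>\<^sub># x' = \<Sum>\<^sub># y'"
    using assms unfolding factorizations_H xy by auto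
  have sz: "size x' < size y'"
    using assms(3) by (simp add: xy)
  have "size x' \<ge> 2"
  proof (rule ccontr)
    assume "\<not> size x' \<ge> 2"
    then consider "x' = {#}" | u where "x' = {#u#}"
      by (metis One_nat_def less_2_cases not_le size_1_singleton_mset size_eq_0_iff_empty)
    then show False
    proof cases
      case 1
      then obtain v y'' where "y' = add_mset v y''"
        using sz by (cases y') auto
      then show False
        using 1 eq at atom_nonempty by auto
    next
      case 2
      obtain v y0 where v: "y' = add_mset v y0"
        using sz by (cases y') auto
      moreover obtain w y'' where "y0 = add_mset w y''"
        using sz 2 v by (cases y0) auto
      ultimately have y'': "y' = {#v, w#} + y''"
        by simp
      have "w + \<Sum>\<^sub># y'' \<in> M" "v \<in> M"
        using at y'' by (auto intro!: add_mem sum_mset_mem simp: atom_mem subset_iff)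
      moreover have "u \<in> atoms H" "u = v + (w + \<Sum>\<^sub># y'')"
        using 2 at eq y'' by (auto simp: ac_simps)
      ultimately have "v = {#} \<or> w = {#}"
        using atom_indecomposable by fastforce
      then show False
        using at y'' atom_nonempty by auto
    qed
  qed
  moreover have "size y' \<le> factorization_dist x y"
    by (simp add: factorization_dist_def y'_def g_def)
  moreover have "size y + size x' = size y' + size x"
    by (simp add: xy)
  ultimately show ?thesis by linarith
qed

abbreviation chain_steps :: "enat \<Rightarrow> 'a multiset \<Rightarrow> ('a multiset multiset \<times> 'a multiset multiset) set"
  where "chain_steps N a \<equiv> {(x, y). x \<in> factorizations H a \<and> y \<in> factorizations H a \<and>
                         enat (factorization_dist x y) \<le> N}"

text \<open>The least bound is attained because \<open>\<infinity>\<close> is one of the bounds.\<close>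

lemma catenary_degree_elem_chain:
  assumes "z \<in> factorizations H a" "z' \<in> factorizations H a"
  shows "(z, z') \<in> (chain_steps (catenary_degree_elem H a) a)\<^sup>*"
proof -
  let ?P = "\<lambda>N. \<forall>z\<in>factorizations H a. \<forall>z'\<in>factorizations H a. (z, z') \<in> (chain_steps N a)\<^sup>*"
  have "?P \<infinity>"
    by (auto intro!: r_into_rtrancl)
  then have "?P (LEAST N. ?P N)"
    by (rule LeastI)
  then show ?thesis
    using assms unfolding catenary_degree_elem_def by blast
qed

text \<open>
  A chain from length \<open>k\<close> to length \<open>k + d\<close> has a single step that jumps over the gap between them.
\<close>

lemma delta_le_catenary_degree:
  assumes "d \<in> delta_monoid H"
  shows "enat (d + 2) \<le> catenary_degree H"
proof -
  obtain a k where a: "a \<in> M" and d: "d \<ge> 1"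
    and k: "int ` length_set H a \<inter> {k..k + int d} = {k, k + int d}"
    using assms by (auto simp: delta_monoid_def system_of_length_sets_def delta_set_def)
  have "k \<in> int ` length_set H a" "k + int d \<in> int ` length_set H a"
    using k by blast+
  then obtain x y where x: "x \<in> factorizations H a" "int (size x) = k"
    and y: "y \<in> factorizations H a" "int (size y) = k + int d"
    by (auto simp: length_set_H)
  have gap: "size v \<ge> size x + d" if "v \<in> factorizations H a" "size v > size x" for v
  proof (rule ccontr)
    assume "\<not> size v \<ge> size x + d"
    then have "int (size v) \<in> int ` length_set H a \<inter> {k..k + int d}"
      using that x by (auto simp: length_set_H)
    then have "int (size v) = k \<or> int (size v) = k + int d"
      unfolding k by simp
    with x that \<open>\<not> size v \<ge> size x + d\<close> show False
      by auto
  qed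
  let ?c = "catenary_degree_elem H a"
  have "\<exists>u v. (u, v) \<in> chain_steps ?c a \<and> size u \<le> size x \<and> size x < size v"
  proof (rule ccontr)
    assume no: "\<not> ?thesis"
    have "size y' \<le> size x" if "(x, y') \<in> (chain_steps ?c a)\<^sup>*" for y'
      using that
    proof (induction rule: rtrancl_induct)
      case (step u v)
      then show ?case using no by (meson not_le)
    qed simp
    then have "size y \<le> size x"
      using catenary_degree_elem_chain x y by blast
    with x y d show False by linarith
  qed
  then obtain u v where uv: "u \<in> factorizations H a" "v \<in> factorizations H a"
    "enat (factorization_dist u v) \<le> ?c" "size u \<le> size x" "size x < size v"
    by auto
  have "d + 2 \<le> factorization_dist u v"
    using factorization_dist_lower_bound[OF uv(1,2)] gap[OF uv(2,5)] uv(4,5) by linarith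
  then have "enat (d + 2) \<le> ?c"
    using uv(3) by (meson enat_ord_simps(1) order_trans)
  also have "\<dots> \<le> catenary_degree H"
    unfolding catenary_degree_def using a by (intro SUP_upper) simp
  finally show ?thesis .
qed

section \<open>The catenary degree is at most omega\<close>

lemma omega_elem_le:
  assumes "\<And>n b. n \<ge> 1 \<Longrightarrow> b \<in> {1..n} \<rightarrow> M \<Longrightarrow> \<exists>c\<in>M. sum b {1..n} = u + c \<Longrightarrow>
             \<exists>\<Omega>\<subseteq>{1..n::nat}. card \<Omega> \<le> N \<and> (\<exists>c\<in>M. sum b \<Omega> = u + c)"
  shows "omega_elem H u \<le> enat N"
  unfolding omega_elem_def
proof (rule Least_le, intro allI impI ballI)
  fix n :: nat and b
  assume n: "n \<ge> 1" and b: "b \<in> {1..n} \<rightarrow> carrier H"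
    and "u divides\<^bsub>H\<^esub> (\<Otimes>\<^bsub>H\<^esub>i\<in>{1..n}. b i)"
  then have "\<exists>c\<in>M. sum b {1..n} = u + c"
    by (simp add: finprod_H divides_H)
  then obtain \<Omega> where \<Omega>: "\<Omega> \<subseteq> {1..n}" "card \<Omega> \<le> N" "\<exists>c\<in>M. sum b \<Omega> = u + c"
    using assms n b by (metis partial_object.select_convs(1))
  have "finite \<Omega>" "b \<in> \<Omega> \<rightarrow> M"
    using \<Omega>(1) b finite_subset by auto
  with \<Omega> show "\<exists>\<Omega>\<subseteq>{1..n}. enat (card \<Omega>) \<le> enat N \<and> u divides\<^bsub>H\<^esub> (\<Otimes>\<^bsub>H\<^esub>i\<in>\<Omega>. b i)"
    by (intro exI[of _ \<Omega>]) (simp add: finprod_H divides_H)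
qed

lemma omega_elem_obtain:
  assumes "omega_elem H u \<le> enat N" "b \<in> {1..n} \<rightarrow> M" "n \<ge> 1" "c \<in> M" "sum b {1..n} = u + c"
  obtains \<Omega> c' where "\<Omega> \<subseteq> {1..n::nat}" "card \<Omega> \<le> N" "c' \<in> M" "sum b \<Omega> = u + c'"
proof -
  let ?P = "\<lambda>N. \<forall>n\<ge>1. \<forall>b \<in> {1..n::nat} \<rightarrow> carrier H.
      u divides\<^bsub>H\<^esub> (\<Otimes>\<^bsub>H\<^esub>i\<in>{1..n}. b i) \<longrightarrow>
      (\<exists>\<Omega>\<subseteq>{1..n}. enat (card \<Omega>) \<le> N \<and> u divides\<^bsub>H\<^esub> (\<Otimes>\<^bsub>H\<^esub>i\<in>\<Omega>. b i))"
  have "?P \<infinity>"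
    by auto
  then have "?P (LEAST N. ?P N)"
    by (rule LeastI)
  then have P: "?P (omega_elem H u)"
    unfolding omega_elem_def .
  have "u divides\<^bsub>H\<^esub> (\<Otimes>\<^bsub>H\<^esub>i\<in>{1..n}. b i)"
    using assms by (auto simp: finprod_H divides_H)
  with P assms(2,3) obtain \<Omega> where \<Omega>: "\<Omega> \<subseteq> {1..n}" "enat (card \<Omega>) \<le> omega_elem H u"
    "u divides\<^bsub>H\<^esub> (\<Otimes>\<^bsub>H\<^esub>i\<in>\<Omega>. b i)"
    by (metis partial_object.select_convs(1))
  have "finite \<Omega>" "b \<in> \<Omega> \<rightarrow> M"
    using \<Omega>(1) assms(2) finite_subset by auto
  then have "\<exists>c\<in>M. sum b \<Omega> = u + c"
    using \<Omega>(3) by (simp add: finprod_H divides_H)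
  moreover have "card \<Omega> \<le> N"
    using \<Omega>(2) assms(1) by (metis enat_ord_simps(1) order_trans)
  ultimately show thesis
    using that \<Omega>(1) by blast
qed

text \<open>
  The definition of omega speaks of indexed families; for factorizations it is needed for
  multisets, where the atoms chosen by \<open>\<Omega>\<close> form a submultiset.
\<close>

lemma sub_factorization_of_omega_elem:
  assumes "omega_elem H u \<le> enat N" "u \<noteq> {#}" "set_mset z \<subseteq> M" "c \<in> M" "\<Sum>\<^sub># z = u + c"
  obtains v c' where "v \<subseteq># z" "size v \<le> N" "c' \<in> M" "\<Sum>\<^sub># v = u + c'"
proof -
  obtain zs where zs: "mset zs = z"
    using ex_mset by blast
  define n where "n = length zs"
  define b where "b i = zs ! (i - 1)" for i
  have im: "image_mset b (mset_set {1..n}) = z"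
  proof -
    have "map b [1..<Suc n] = zs"
      by (rule nth_equalityI) (auto simp: b_def n_def nth_append simp del: upt_Suc)
    then show ?thesis
      using zs by (metis atLeastLessThanSuc_atLeastAtMost mset_map mset_upt)
  qed
  have b: "b \<in> {1..n} \<rightarrow> M"
    using assms(3) zs by (auto simp: b_def n_def subset_iff)
  have "n \<ge> 1"
    using assms(2,5) zs by (cases zs) (auto simp: n_def)
  moreover have "sum b {1..n} = u + c"
    using assms(5) im by (metis sum_unfold_sum_mset)
  ultimately obtain \<Omega> c' where \<Omega>: "\<Omega> \<subseteq> {1..n}" "card \<Omega> \<le> N" "c' \<in> M" "sum b \<Omega> = u + c'"
    using omega_elem_obtain[OF assms(1) b _ assms(4)] by blast
  have "image_mset b (mset_set \<Omega>) \<subseteq># z"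
    unfolding im[symmetric] using \<Omega>(1) by (intro image_mset_subseteq_mono) (simp add: subset_imp_msubset_mset_set)
  then show thesis
    using \<Omega> by (intro that[of "image_mset b (mset_set \<Omega>)" c']) (auto simp: sum_unfold_sum_mset)
qed

lemma chain_steps_add:
  assumes "(x, y) \<in> (chain_steps N a)\<^sup>*" "w \<in> factorizations H b"
  shows "(x + w, y + w) \<in> (chain_steps N (a + b))\<^sup>*"
  using assms(1)
proof (induction rule: rtrancl_induct)
  case (step y z)
  have "(y + w) - (y + w) \<inter># (z + w) = y - y \<inter># z" "(z + w) - (y + w) \<inter># (z + w) = z - y \<inter># z"
    by (auto simp: multiset_eq_iff)
  then have "factorization_dist (y + w) (z + w) = factorization_dist y z"
    by (simp add: factorization_dist_def)
  then have "(y + w, z + w) \<in> chain_steps N (a + b)"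
    using step.hyps(2) assms(2) by (auto simp: factorizations_H)
  with step.IH show ?case by (rule rtrancl_into_rtrancl)
qed simp

lemma chain_steps_sym:
  assumes "(x, y) \<in> (chain_steps N a)\<^sup>*"
  shows "(y, x) \<in> (chain_steps N a)\<^sup>*"
proof -
  have "sym (chain_steps N a)"
    by (auto simp: sym_def factorization_dist_commute)
  then show ?thesis
    using assms by (meson sym_def sym_rtrancl)
qed

text \<open>
  If both factorizations have at most \<open>N\<close> atoms, they form a single step. Otherwise let the first
  one be the long one and let \<open>u\<close> be an atom of the other. As \<open>\<omega>(H, u) \<le> N\<close>, at most \<open>N\<close> atoms of
  the long factorization suffice for a product that is divisible by \<open>u\<close>. That product is a proper
  divisor of \<open>a\<close>, so induction rewrites this part of the factorization to one that contains \<open>u\<close>.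
  Then \<open>u\<close> is common to both sides, and induction applies to the cofactor of \<open>u\<close>.
\<close>

lemma chain_of_omega:
  assumes omega: "\<And>u. u \<in> atoms H \<Longrightarrow> omega_elem H u \<le> enat N"
  shows "z \<in> factorizations H a \<Longrightarrow> z' \<in> factorizations H a \<Longrightarrow> (z, z') \<in> (chain_steps (enat N) a)\<^sup>*"
proof (induction "size a" arbitrary: a z z' rule: less_induct)
  case less
  have long: "(x, y) \<in> (chain_steps (enat N) a)\<^sup>*"
    if x: "x \<in> factorizations H a" and y: "y \<in> factorizations H a" and sz: "size x > N" for x y
  proof -
    have xM: "set_mset x \<subseteq> M" and yM: "set_mset y \<subseteq> M"
      using x y atom_mem by (auto simp: factorizations_H)
    have "a \<noteq> {#}"
      using x sz atom_nonempty by (cases x) (auto simp: factorizations_H)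
    then obtain u y' where u: "y = add_mset u y'"
      using y by (cases y) (auto simp: factorizations_H)
    have ua: "u \<in> atoms H" and y': "y' \<in> factorizations H (\<Sum>\<^sub># y')"
      and a: "a = u + \<Sum>\<^sub># y'"
      using y u by (auto simp: factorizations_H)
    have "\<Sum>\<^sub># y' \<in> M"
      using yM u by (intro sum_mset_mem) auto
    moreover have "\<Sum>\<^sub># x = u + \<Sum>\<^sub># y'"
      using x a by (simp add: factorizations_H)
    ultimately obtain v c where v: "v \<subseteq># x" "size v \<le> N" and c: "c \<in> M" "\<Sum>\<^sub># v = u + c"
      using sub_factorization_of_omega_elem[OF omega[OF ua] atom_nonempty[OF ua] xM] by blast
    define r where "r = x - v"
    have xr: "x = v + r"
      using v by (simp add: r_def)
    have v': "v \<in> factorizations H (\<Sum>\<^sub># v)" and r: "r \<in> factorizations H (\<Sum>\<^sub># r)"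
      and ar: "a = \<Sum>\<^sub># v + \<Sum>\<^sub># r"
      using x xr by (auto simp: factorizations_H)
    have "r \<noteq> {#}"
      using sz v xr by auto
    then have "\<Sum>\<^sub># r \<noteq> {#}"
      using r atom_nonempty by (cases r) (auto simp: factorizations_H)
    then have less_v: "size (\<Sum>\<^sub># v) < size a"
      unfolding ar size_union by (metis less_add_same_cancel1 nonempty_has_size)
    obtain w where w: "w \<in> factorizations H c"
      using ex_factorization c by blast
    have "add_mset u w \<in> factorizations H (\<Sum>\<^sub># v)"
      using w ua c by (simp add: factorizations_H)
    then have "(v, add_mset u w) \<in> (chain_steps (enat N) (\<Sum>\<^sub># v))\<^sup>*"
      using less.hyps less_v v' by blast
    then have first: "(x, add_mset u (w + r)) \<in> (chain_steps (enat N) a)\<^sup>*"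
      using chain_steps_add[OF _ r] by (fastforce simp: xr ar)
    have "w + r \<in> factorizations H (\<Sum>\<^sub># y')"
      using w r c ar a by (auto simp: factorizations_H add.assoc)
    moreover have "size (\<Sum>\<^sub># y') < size a"
      using a atom_nonempty[OF ua] by (simp add: nonempty_has_size)
    ultimately have "(w + r, y') \<in> (chain_steps (enat N) (\<Sum>\<^sub># y'))\<^sup>*"
      using less.hyps y' by blast
    moreover have "{#u#} \<in> factorizations H u"
      using ua by (simp add: factorizations_H)
    ultimately have "(w + r + {#u#}, y' + {#u#}) \<in> (chain_steps (enat N) (\<Sum>\<^sub># y' + u))\<^sup>*"
      by (rule chain_steps_add)
    then have "(add_mset u (w + r), y) \<in> (chain_steps (enat N) a)\<^sup>*"
      by (simp add: u a add.commute)
    with first show ?thesis by (rule rtrancl_trans)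
  qed
  show ?case
  proof (cases "size z > N \<or> size z' > N")
    case True
    then show ?thesis
      using long less.prems chain_steps_sym by blast
  next
    case False
    have "factorization_dist z z' \<le> max (size z) (size z')"
      unfolding factorization_dist_def
      by (intro max.mono size_mset_mono) auto
    with False less.prems have "(z, z') \<in> chain_steps (enat N) a"
      by auto
    then show ?thesis by blast
  qed
qed

lemma catenary_degree_le:
  assumes "omega_monoid H \<le> enat N"
  shows "catenary_degree H \<le> enat N"
proof -
  have "omega_elem H u \<le> enat N" if "u \<in> atoms H" for u
    using assms that unfolding omega_monoid_def by (meson SUP_le_iff)
  then have "catenary_degree_elem H a \<le> enat N" for a
    unfolding catenary_degree_elem_def using chain_of_omega by (intro Least_le ballI) blast
  then show ?thesis
    unfolding catenary_degree_def by (intro SUP_least) blast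
qed

corollary catenary_degree_le_omega: "catenary_degree H \<le> omega_monoid H"
  using catenary_degree_le by (cases "omega_monoid H") auto

end

section \<open>Signed sums of integer weights\<close>

definition signed_sums :: "('a \<Rightarrow> int) \<Rightarrow> 'a multiset \<Rightarrow> int set"
  where "signed_sums e S =
    {\<Sum>\<^sub># (image_mset e P) - \<Sum>\<^sub># (image_mset e N) | P N. S = P + N}"

lemma signed_sums_empty [simp]: "signed_sums e {#} = {0}"
  by (auto simp: signed_sums_def)

lemma signed_sums_nonempty: "signed_sums e S \<noteq> {}"
  unfolding signed_sums_def by (metis (mono_tags, lifting) add.right_neutral empty_iff mem_Collect_eq)

lemma signed_sums_add_mset:
  "signed_sums e (add_mset x S) = (\<lambda>s. s + e x) ` signed_sums e S \<union> (\<lambda>s. s - e x) ` signed_sums e S"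
  (is "?L = ?R")
proof
  show "?L \<subseteq> ?R"
  proof
    fix s assume "s \<in> ?L"
    then obtain P N where PN: "add_mset x S = P + N"
      and s: "s = \<Sum>\<^sub># (image_mset e P) - \<Sum>\<^sub># (image_mset e N)"
      by (auto simp: signed_sums_def)
    have "x \<in># P \<or> x \<in># N"
      using PN by (metis union_iff union_single_eq_member)
    then consider P' where "P = add_mset x P'" | N' where "N = add_mset x N'"
      by (meson multi_member_split)
    then show "s \<in> ?R"
    proof cases
      case 1
      then have "\<Sum>\<^sub># (image_mset e P') - \<Sum>\<^sub># (image_mset e N) \<in> signed_sums e S"
        using PN by (auto simp: signed_sums_def)
      then show ?thesis
        using 1 s by (force intro!: image_eqI)
    next
      case 2
      then have "\<Sum>\<^sub># (image_mset e P) - \<Sum>\<^sub># (image_mset e N') \<in> signed_sums e S"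
        using PN by (auto simp: signed_sums_def)
      then show ?thesis
        using 2 s by (force intro!: image_eqI)
    qed
  qed
next
  have "s + e x \<in> ?L \<and> s - e x \<in> ?L" if s: "s \<in> signed_sums e S" for s
  proof -
    obtain P N where S: "S = P + N" and s: "s = \<Sum>\<^sub># (image_mset e P) - \<Sum>\<^sub># (image_mset e N)"
      using s unfolding signed_sums_def by blast
    have "s + e x = \<Sum>\<^sub># (image_mset e (add_mset x P)) - \<Sum>\<^sub># (image_mset e N)"
      "add_mset x S = add_mset x P + N"
      "s - e x = \<Sum>\<^sub># (image_mset e P) - \<Sum>\<^sub># (image_mset e (add_mset x N))"
      "add_mset x S = P + add_mset x N"
      using S s by auto
    then show ?thesis
      unfolding signed_sums_def by blast
  qed
  then show "?R \<subseteq> ?L" by auto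
qed

lemma signed_sums_union:
  assumes "s \<in> signed_sums e A" "t \<in> signed_sums e B"
  shows "s + t \<in> signed_sums e (A + B)"
  using assms(2)
proof (induction B arbitrary: t)
  case empty
  then show ?case using assms(1) by simp
next
  case (add x B)
  then obtain t' where t': "t' \<in> signed_sums e B" "t = t' + e x \<or> t = t' - e x"
    by (auto simp: signed_sums_add_mset)
  have "s + t' \<in> signed_sums e (A + B)"
    using add.IH t' by blast
  moreover have "s + t = (s + t') + e x \<or> s + t = (s + t') - e x"
    using t' by auto
  ultimately show ?case
    by (auto simp: signed_sums_add_mset)
qed

lemma signed_sums_replicate:
  assumes "e g = 1"
  shows "signed_sums e (replicate_mset n g) = {2 * int i - int n | i. i \<le> n}"
proof (induction n)
  case (Suc n)
  have iff: "(\<exists>i\<le>n. s = 2 * int i - int n + 1 \<or> s = 2 * int i - int n - 1) \<longleftrightarrow>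
        (\<exists>i\<le>Suc n. s = 2 * int i - int (Suc n))" for s :: int
  proof
    assume "\<exists>i\<le>n. s = 2 * int i - int n + 1 \<or> s = 2 * int i - int n - 1"
    then consider i where "i \<le> n" "s = 2 * int i - int n + 1" | i where "i \<le> n" "s = 2 * int i - int n - 1"
      by blast
    then show "\<exists>i\<le>Suc n. s = 2 * int i - int (Suc n)"
    proof cases
      case (1 i)
      then show ?thesis by (intro exI[of _ "Suc i"]) simp
    next
      case (2 i)
      then show ?thesis by (intro exI[of _ i]) simp
    qed
  next
    assume "\<exists>i\<le>Suc n. s = 2 * int i - int (Suc n)"
    then obtain i where i: "i \<le> Suc n" "s = 2 * int i - int (Suc n)" by blast
    show "\<exists>i\<le>n. s = 2 * int i - int n + 1 \<or> s = 2 * int i - int n - 1"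
    proof (cases "i = Suc n")
      case True
      then show ?thesis using i by (intro exI[of _ n]) auto
    next
      case False
      then show ?thesis using i by (intro exI[of _ i]) auto
    qed
  qed
  have "s \<in> signed_sums e (replicate_mset (Suc n) g) \<longleftrightarrow>
        (\<exists>i\<le>n. s = 2 * int i - int n + 1 \<or> s = 2 * int i - int n - 1)" for s
    unfolding replicate_mset_Suc signed_sums_add_mset Suc assms by blast
  then show ?case
    unfolding iff by blast
qed auto

lemma signed_sums_add_weight:
  assumes "e g = 1" "e h = w"
  shows "s \<in> signed_sums e (add_mset h (replicate_mset n g)) \<longleftrightarrow>
     (\<exists>i\<le>n. s = 2 * int i - int n + w \<or> s = 2 * int i - int n - w)"
  unfolding signed_sums_add_mset signed_sums_replicate[where e = e and g = g, OF assms(1)] assms(2) by blast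

text \<open>
  This is the Cauchy--Davenport inequality for a summand \<open>{x, -x}\<close>. If the two translates of \<open>A\<close>
  coincide, then \<open>A\<close> is invariant under the translation by \<open>2 x\<close>, a generator of the
  group of residues.
\<close>

lemma card_translates_ge:
  fixes p :: nat and x :: int
  assumes p: "Factorial_Ring.prime p" "p \<ge> 3" and x: "\<not> int p dvd x"
    and A: "A \<subseteq> {0..<int p}" "A \<noteq> {}"
  shows "card ((\<lambda>a. (a + x) mod int p) ` A \<union> (\<lambda>a. (a - x) mod int p) ` A) \<ge> min p (card A + 1)"
    (is "card (?f ` A \<union> ?g ` A) \<ge> _")
proof -
  have fin: "finite A"
    using A finite_subset by blast
  have "inj_on (\<lambda>a. (a + y) mod int p) A" for y
  proof (rule inj_onI)
    fix a b assume ab: "a \<in> A" "b \<in> A" "(a + y) mod int p = (b + y) mod int p"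
    then have "a mod int p = b mod int p"
      by (metis add_diff_cancel_right' mod_diff_left_eq)
    with ab A(1) show "a = b"
      by (auto simp: subset_iff)
  qed
  from this[of x] this[of "-x"] have cf: "card (?f ` A) = card A" "card (?g ` A) = card A"
    by (simp_all add: card_image)
  show ?thesis
  proof (cases "card (?f ` A \<union> ?g ` A) > card A")
    case False
    then have "?f ` A = ?f ` A \<union> ?g ` A" "?g ` A = ?f ` A \<union> ?g ` A"
      using fin cf by (intro card_seteq; force)+
    then have eq: "?f ` A = ?g ` A" by simp
    have step: "(a + 2 * x) mod int p \<in> A" if "a \<in> A" for a
    proof -
      obtain b where b: "b \<in> A" "(a + x) mod int p = (b - x) mod int p"
        using eq \<open>a \<in> A\<close> by blast
      then have "(a + 2 * x) mod int p = b mod int p"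
        by (metis add.assoc diff_add_cancel mod_add_left_eq mult_2)
      with b(1) A(1) show ?thesis
        by (auto simp: subset_iff)
    qed
    have steps: "(a + int k * (2 * x)) mod int p \<in> A" if "a \<in> A" for a k
    proof (induction k)
      case 0
      then show ?case using that A(1) by (auto simp: subset_iff)
    next
      case (Suc k)
      then have "((a + int k * (2 * x)) mod int p + 2 * x) mod int p \<in> A"
        by (rule step)
      then show ?case
        unfolding mod_add_left_eq by (simp add: algebra_simps)
    qed
    have "coprime (2 * x) (int p)"
    proof -
      have pi: "Factorial_Ring.prime (int p)"
        using p(1) by simp
      have "\<not> p dvd 2"
        using p by (auto dest: dvd_imp_le)
      then have "\<not> int p dvd 2"
        by (metis int_dvd_int_iff of_nat_numeral)
      then have "\<not> int p dvd 2 * x"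
        using x Factorial_Ring.prime_dvd_mult_iff[OF pi] by blast
      then show ?thesis
        using Factorial_Ring.prime_imp_coprime[OF pi] coprime_commute by blast
    qed
    then obtain y where y: "[2 * x * y = 1] (mod int p)"
      using cong_solve_coprime_int by blast
    \<comment> \<open>As \<open>y\<close> inverts \<open>2 x\<close>, the residue \<open>t\<close> is reached from \<open>a\<close> in \<open>y (t - a) mod p\<close> steps.\<close>
    have "{0..<int p} \<subseteq> A"
    proof
      fix t assume t: "t \<in> {0..<int p}"
      obtain a where a: "a \<in> A" using A(2) by blast
      define k where "k = nat ((y * (t - a)) mod int p)"
      have "int k = (y * (t - a)) mod int p"
        using p by (simp add: k_def)
      then have "[int k * (2 * x) = (y * (t - a)) * (2 * x)] (mod int p)"
        by (intro cong_mult) (auto simp: cong_def)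
      also have "(y * (t - a)) * (2 * x) = (2 * x * y) * (t - a)"
        by simp
      also have "[(2 * x * y) * (t - a) = 1 * (t - a)] (mod int p)"
        using y by (rule cong_mult) simp
      finally have "[a + int k * (2 * x) = a + 1 * (t - a)] (mod int p)"
        by (intro cong_add) auto
      then have "(a + int k * (2 * x)) mod int p = t"
        using t by (simp add: cong_def)
      then show "t \<in> A"
        using steps[OF a, of k] by simp
    qed
    then have "card A = p"
      using A(1) by (metis card_atLeastLessThan_int diff_zero nat_int subset_antisym)
    moreover have "card (?f ` A) \<le> card (?f ` A \<union> ?g ` A)"
      using fin by (intro card_mono) auto
    ultimately show ?thesis
      using cf by simp
  qed simp
qed

section \<open>Sequences over the residues modulo a prime with signed sum zero\<close>

text \<open>
  The elements of \<open>C\<close> are named by their residues, so that signed sums become sums of integers.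
  For a cyclic group, \<open>e\<close> is the discrete logarithm.
\<close>

locale prime_residues =
  fixes p :: nat and C :: "'a set" and e :: "'a \<Rightarrow> int"
  assumes prime_p: "Factorial_Ring.prime p" and p_ge_3: "p \<ge> 3"
    and bij_e: "bij_betw e C {0..<int p}"
begin

definition zero_sums :: "'a multiset set"
  where "zero_sums = {S. set_mset S \<subseteq> C \<and> (\<exists>s\<in>signed_sums e S. int p dvd s)}"

sublocale multiset_monoid zero_sums
proof
  show "{#} \<in> zero_sums"
    by (simp add: zero_sums_def)
  fix a b assume "a \<in> zero_sums" "b \<in> zero_sums"
  then show "a + b \<in> zero_sums"
    by (auto simp: zero_sums_def) (meson dvd_add signed_sums_union)
qed

abbreviation nonzero :: "'a \<Rightarrow> bool"
  where "nonzero x \<equiv> \<not> int p dvd e x"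

abbreviation nonzero_part :: "'a multiset \<Rightarrow> 'a multiset"
  where "nonzero_part S \<equiv> filter_mset nonzero S"

lemma odd_p: "odd p"
  using prime_p p_ge_3 prime_odd_nat by force

lemma ex_weight:
  assumes "a < p"
  obtains x where "x \<in> C" "e x = int a"
proof -
  have "int a \<in> e ` C"
    using bij_e assms by (simp add: bij_betw_def)
  then show thesis using that by force
qed

lemma zero_sums_of_zeros:
  assumes "set_mset Z \<subseteq> C" "\<And>x. x \<in># Z \<Longrightarrow> \<not> nonzero x"
  shows "Z \<in> zero_sums"
proof -
  have "\<Sum>\<^sub># (image_mset e Z) - \<Sum>\<^sub># (image_mset e {#}) \<in> signed_sums e Z"
    unfolding signed_sums_def by (intro CollectI exI[of _ Z] exI[of _ "{#}"]) simp
  moreover have "int p dvd \<Sum>\<^sub># (image_mset e Z)"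
    using assms(2) by (induction Z) auto
  ultimately show ?thesis
    using assms(1) by (auto simp: zero_sums_def)
qed

lemma zero_sums_cancel_zeros:
  assumes "S + Z \<in> zero_sums" "\<And>x. x \<in># Z \<Longrightarrow> \<not> nonzero x"
  shows "S \<in> zero_sums"
proof -
  have "\<exists>s\<in>signed_sums e S. int p dvd s" if "\<exists>s\<in>signed_sums e (S + Z). int p dvd s"
    using that assms(2)
  proof (induction Z)
    case (add x Z)
    then obtain s where s: "s \<in> signed_sums e (S + Z)" "int p dvd s + e x \<or> int p dvd s - e x"
      by (auto simp: signed_sums_add_mset)
    have "int p dvd e x"
      using add.prems(2) by simp
    with s(2) have "int p dvd s"
      by (auto simp: dvd_add_left_iff dvd_diff_left_iff)
    with s(1) show ?case
      using add.IH add.prems(2) by auto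
  qed simp
  then show ?thesis
    using assms(1) by (auto simp: zero_sums_def)
qed

text \<open>One residue comes from the empty sum, and each nonzero element adds at least one more.\<close>

lemma signed_sums_residues:
  assumes "\<And>x. x \<in># S \<Longrightarrow> nonzero x"
  shows "card ((\<lambda>s. s mod int p) ` signed_sums e S) \<ge> min p (size S + 1)"
  using assms
proof (induction S)
  case (add x S)
  let ?r = "\<lambda>s. s mod int p"
  let ?A = "?r ` signed_sums e S"
  have "card ((\<lambda>a. (a + e x) mod int p) ` ?A \<union> (\<lambda>a. (a - e x) mod int p) ` ?A) \<ge> min p (card ?A + 1)"
  proof (rule card_translates_ge[OF prime_p p_ge_3])
    show "nonzero x"
      using add.prems by simp
    show "?A \<subseteq> {0..<int p}" "?A \<noteq> {}"
      using p_ge_3 by (auto simp: signed_sums_nonempty)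
  qed
  also have "(\<lambda>a. (a + e x) mod int p) ` ?A \<union> (\<lambda>a. (a - e x) mod int p) ` ?A
      = ?r ` signed_sums e (add_mset x S)"
    by (simp add: signed_sums_add_mset image_Un image_image mod_add_left_eq mod_diff_left_eq)
  finally show ?case
    using add.IH add.prems by auto
qed (use p_ge_3 in auto)

text \<open>
  Each nonzero element enlarges the set of signed sums until it consists of all residues, so after
  \<open>p - 1\<close> of them the residue \<open>0\<close> is reached. All upper bounds by \<open>p\<close> rest on this: a long
  sequence stays in the monoid whatever is removed from it, as long as it stays long.
\<close>

lemma zero_sums_of_many_nonzero:
  assumes "set_mset S \<subseteq> C" "size (nonzero_part S) \<ge> p - 1"
  shows "S \<in> zero_sums"
proof -
  let ?R = "(\<lambda>s. s mod int p) ` signed_sums e (nonzero_part S)"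
  have "card ?R \<ge> p"
    using signed_sums_residues[of "nonzero_part S"] assms(2) by auto
  moreover have "?R \<subseteq> {0..<int p}"
    using p_ge_3 by auto
  ultimately have "?R = {0..<int p}"
    by (intro card_seteq) auto
  then have "0 \<in> ?R"
    using p_ge_3 by simp
  then have "\<exists>s\<in>signed_sums e (nonzero_part S). int p dvd s"
    by (metis (no_types, lifting) imageE mod_0_imp_dvd)
  then have "nonzero_part S \<in> zero_sums"
    using assms(1) by (auto simp: zero_sums_def)
  moreover have "filter_mset (\<lambda>x. \<not> nonzero x) S \<in> zero_sums"
    using assms(1) by (intro zero_sums_of_zeros) auto
  ultimately have "nonzero_part S + filter_mset (\<lambda>x. \<not> nonzero x) S \<in> zero_sums"
    by (rule add_mem)
  then show ?thesis
    by (simp flip: multiset_partition)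
qed

text \<open>A single nonzero element \<open>x\<close> has only the nonzero signed sums \<open>x\<close> and \<open>-x\<close>.\<close>

lemma size_nonzero_part_ge_2:
  assumes "S \<in> zero_sums" "nonzero_part S \<noteq> {#}"
  shows "size (nonzero_part S) \<ge> 2"
proof (rule ccontr)
  assume "\<not> ?thesis"
  moreover have "size (nonzero_part S) > 0"
    using assms(2) nonempty_has_size by blast
  ultimately have "size (nonzero_part S) = 1"
    by linarith
  then obtain x where x: "nonzero_part S = {#x#}"
    by (blast dest: size_1_singleton_mset)
  have "nonzero_part S + filter_mset (\<lambda>x. \<not> nonzero x) S \<in> zero_sums"
    using assms(1) by (simp flip: multiset_partition)
  then have "nonzero_part S \<in> zero_sums"
    by (rule zero_sums_cancel_zeros) auto
  then have "\<not> nonzero x"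
    unfolding x by (auto simp: zero_sums_def signed_sums_add_mset)
  moreover have "x \<in># nonzero_part S"
    by (simp add: x)
  ultimately show False by simp
qed

lemma atom_with_zero:
  assumes "u \<in> atoms H" "x \<in># u" "\<not> nonzero x"
  shows "u = {#x#}"
proof -
  obtain v where v: "u = v + {#x#}"
    using assms(2) by (metis add_mset_add_single multi_member_split)
  have "v + {#x#} \<in> zero_sums"
    using atom_mem[OF assms(1)] unfolding v .
  then have "v \<in> zero_sums"
    using zero_sums_cancel_zeros[of v "{#x#}"] assms(3) by simp
  moreover have "{#x#} \<in> zero_sums"
    using assms(2,3) atom_mem[OF assms(1)] by (intro zero_sums_of_zeros) (auto simp: zero_sums_def)
  ultimately show ?thesis
    using atom_indecomposable[OF assms(1) v] v by auto
qed

text \<open>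
  A longer sequence of nonzero elements would contain some element twice, and after removing this
  pair it would still have \<open>p - 1\<close> nonzero elements.
\<close>

lemma size_atom_le:
  assumes u: "u \<in> atoms H"
  shows "size u \<le> p"
proof (rule ccontr)
  assume big: "\<not> size u \<le> p"
  have nz: "\<forall>x\<in>#u. nonzero x"
  proof (intro ballI notI)
    fix x assume "x \<in># u" "int p dvd e x"
    then have "u = {#x#}"
      using atom_with_zero[OF u] by blast
    with big p_ge_3 show False by simp
  qed
  have uC: "set_mset u \<subseteq> C"
    using atom_mem[OF u] by (simp add: zero_sums_def)
  have "\<exists>x. count u x \<ge> 2"
  proof (rule ccontr)
    assume "\<nexists>x. count u x \<ge> 2"
    then have "size u \<le> (\<Sum>x\<in>set_mset u. 1)"
      unfolding size_multiset_overloaded_eq by (intro sum_mono) (simp add: not_le less_Suc_eq_le numeral_2_eq_2)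
    also have "\<dots> \<le> card C"
      using uC bij_e by (simp add: bij_betw_finite card_mono)
    also have "card C = p"
      using bij_betw_same_card[OF bij_e] by simp
    finally show False using big by simp
  qed
  then obtain x where "count u x \<ge> 2" by blast
  then have "replicate_mset 2 x \<subseteq># u"
    by (simp add: count_le_replicate_mset_subset_eq)
  then obtain v where v: "u = replicate_mset 2 x + v"
    by (metis mset_subset_eq_exists_conv)
  have "nonzero_part v = v"
    using nz v by (simp add: filter_mset_eq_conv)
  then have "v \<in> zero_sums"
    using big v uC by (intro zero_sums_of_many_nonzero) auto
  moreover have "replicate_mset 2 x \<in> zero_sums"
    using uC v by (auto simp: zero_sums_def signed_sums_add_mset numeral_2_eq_2)
  ultimately have "replicate_mset 2 x = {#} \<or> v = {#}"
    using atom_indecomposable[OF u v] by blast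
  then show False
    using v big p_ge_3 by auto
qed

text \<open>
  An atom \<open>u\<close> of nonzero elements is covered by at most \<open>p\<close> of the given factors. The complement of \<open>u\<close>
  must again have signed sum zero, and it does as soon as \<open>p\<close> factors with nonzero elements are
  used: each contains at least two of them, and at most \<open>p\<close> of these \<open>2 p\<close> are used up by \<open>u\<close>.
  With fewer than \<open>p\<close> such factors one may take them all.
\<close>

lemma omega_elem_le_p:
  assumes u: "u \<in> atoms H"
  shows "omega_elem H u \<le> enat p"
proof (rule omega_elem_le)
  fix n :: nat and b
  assume b: "b \<in> {1..n} \<rightarrow> zero_sums" and "\<exists>c\<in>zero_sums. sum b {1..n} = u + c"
  then obtain c where c: "c \<in> zero_sums" "sum b {1..n} = u + c" by blast
  have bm: "b i \<in> zero_sums" if "i \<in> {1..n}" for i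
    using b that by auto
  show "\<exists>\<Omega>\<subseteq>{1..n}. card \<Omega> \<le> p \<and> (\<exists>c\<in>zero_sums. sum b \<Omega> = u + c)"
  proof (cases "\<forall>x\<in>#u. nonzero x")
    case False
    then obtain x where x: "u = {#x#}" "\<not> nonzero x"
      using atom_with_zero[OF u] by blast
    have "u \<subseteq># sum b {1..n}"
      unfolding c(2) by simp
    then have "\<exists>J\<subseteq>{1..n}. card J \<le> size u \<and> u \<subseteq># sum b J"
      by (intro subseteq_sum_cover) auto
    then obtain J where J: "J \<subseteq> {1..n}" "card J \<le> 1" "u \<subseteq># sum b J"
      using x by auto
    then obtain c' where c': "sum b J = c' + u"
      by (metis subset_mset.diff_add)
    have "c' + u \<in> zero_sums"
      unfolding c'[symmetric] using J(1) bm by (intro sum_mem) auto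
    then have "c' \<in> zero_sums"
      by (rule zero_sums_cancel_zeros) (use x in auto)
    then show ?thesis
      using J c' p_ge_3 by (intro exI[of _ J]) (auto simp: add.commute)
  next
    case nz: True
    define J where "J = {i \<in> {1..n}. nonzero_part (b i) \<noteq> {#}}"
    have J: "J \<subseteq> {1..n}" and fJ: "finite J"
      by (auto simp: J_def)
    have split: "sum b {1..n} = sum b J + sum b ({1..n} - J)"
      using J by (metis add.commute finite_atLeastAtMost sum.subset_diff)
    have zeros: "\<not> nonzero x" if x: "x \<in># sum b ({1..n} - J)" for x
    proof -
      obtain i where "i \<in> {1..n} - J" "x \<in># b i"
        using mem_sum_multisets[OF x] by blast
      then show ?thesis
        by (auto simp: J_def)
    qed
    have uJ: "u \<subseteq># sum b J"
    proof (rule mset_subset_eqI)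
      fix x
      show "count u x \<le> count (sum b J) x"
      proof (cases "x \<in># u")
        case True
        then have "count (sum b ({1..n} - J)) x = 0"
          using nz zeros by (metis count_inI)
        moreover have "count u x \<le> count (sum b {1..n}) x"
          unfolding c(2) by simp
        ultimately show ?thesis unfolding split by simp
      qed (simp add: not_in_iff)
    qed
    show ?thesis
    proof (cases "card J \<le> p")
      case True
      obtain c' where c': "sum b J = u + c'"
        using uJ by (metis mset_subset_eq_exists_conv)
      have "c' + sum b ({1..n} - J) = c"
        using c(2) split c' by (simp add: add.assoc)
      then have "c' \<in> zero_sums"
        using c(1) zeros by (metis zero_sums_cancel_zeros)
      then show ?thesis
        using True J c' by blast
    next
      case False
      obtain K where K: "K \<subseteq> J" "card K \<le> size u" "u \<subseteq># sum b K"
        using subseteq_sum_cover[OF fJ uJ] by blast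
      have "card K \<le> p"
        using K(2) size_atom_le[OF u] by simp
      then obtain \<Omega> where \<Omega>: "K \<subseteq> \<Omega>" "\<Omega> \<subseteq> J" "card \<Omega> = p"
        using exists_subset_between[of K p J] K(1) False fJ by auto
      have f\<Omega>: "finite \<Omega>"
        using \<Omega>(2) fJ finite_subset by blast
      have "sum b \<Omega> = sum b K + sum b (\<Omega> - K)"
        using \<Omega>(1) f\<Omega> by (metis add.commute sum.subset_diff)
      then have "u \<subseteq># sum b \<Omega>"
        using K(3) by (simp add: subset_mset.add_increasing2)
      then obtain c' where c': "sum b \<Omega> = u + c'"
        by (metis mset_subset_eq_exists_conv)
      have "2 * p = (\<Sum>i\<in>\<Omega>. 2)"
        by (simp add: \<Omega>(3))
      also have "\<dots> \<le> (\<Sum>i\<in>\<Omega>. size (nonzero_part (b i)))"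
        using \<Omega>(2) J bm by (intro sum_mono size_nonzero_part_ge_2) (auto simp: J_def)
      also have "\<dots> = size (nonzero_part (sum b \<Omega>))"
        using f\<Omega> by (induction \<Omega> rule: finite_induct) auto
      also have "\<dots> \<le> size u + size (nonzero_part c')"
        by (simp add: c' size_filter_mset_lesseq)
      finally have "p \<le> size (nonzero_part c')"
        using size_atom_le[OF u] by simp
      moreover have "sum b \<Omega> \<in> zero_sums"
        using \<Omega>(2) J bm by (intro sum_mem) auto
      then have "set_mset c' \<subseteq> C"
        by (simp add: c' zero_sums_def)
      ultimately have "c' \<in> zero_sums"
        by (intro zero_sums_of_many_nonzero) auto
      then show ?thesis
        using \<Omega> J c' by (intro exI[of _ \<Omega>]) auto
    qed
  qed
qed

corollary omega_monoid_le_p: "omega_monoid H \<le> enat p"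
  unfolding omega_monoid_def using omega_elem_le_p by (rule SUP_least)

section \<open>All gaps between 1 and p - 2 occur\<close>

text \<open>
  The signed sums of \<open>n\<close> copies of 1 are the integers in \<open>[-n, n]\<close> of the parity of \<open>n\<close>. For odd
  \<open>n\<close> the first of them that \<open>p\<close> divides are \<open>p\<close> and \<open>-p\<close>.
\<close>

lemma replicate_mem_iff:
  assumes "g \<in> C" "e g = 1"
  shows "replicate_mset n g \<in> zero_sums \<longleftrightarrow> even n \<or> n \<ge> p"
proof
  assume "replicate_mset n g \<in> zero_sums"
  then obtain i where i: "i \<le> n" "int p dvd 2 * int i - int n"
    by (auto simp: zero_sums_def signed_sums_replicate[where e = e and g = g, OF assms(2)])
  show "even n \<or> n \<ge> p"
  proof (rule ccontr)
    assume "\<not> (even n \<or> n \<ge> p)"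
    then have "2 * int i - int n \<noteq> 0" "\<bar>2 * int i - int n\<bar> < int p"
      using i(1) by presburger+
    then show False
      using i(2) zdvd_imp_le[of "int p" "\<bar>2 * int i - int n\<bar>"] by auto
  qed
next
  assume n: "even n \<or> n \<ge> p"
  have "\<exists>i\<le>n. int p dvd 2 * int i - int n"
  proof (cases "even n")
    case True
    then obtain i where "n = 2 * i" by blast
    then show ?thesis by (intro exI[of _ i]) simp
  next
    case False
    then have "even (n + p)" "n \<ge> p"
      using n odd_p by auto
    then obtain i where "n + p = 2 * i" by blast
    then have "2 * int i - int n = int p" "i \<le> n"
      using \<open>n \<ge> p\<close> by linarith+
    then show ?thesis by (intro exI[of _ i]) simp
  qed
  then show "replicate_mset n g \<in> zero_sums"
    using assms(1)
    by (auto simp: zero_sums_def signed_sums_replicate[where e = e and g = g, OF assms(2)] split: if_splits)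
qed

text \<open>
  Longer even powers of \<open>g\<close> split off a pair, and longer odd powers split off \<open>g\<^sup>p\<close>. Conversely,
  a splitting of \<open>g\<^sup>p\<close> would have an odd part that is shorter than \<open>p\<close>.
\<close>

lemma replicate_atom_iff:
  assumes g: "g \<in> C" "e g = 1"
  shows "replicate_mset n g \<in> atoms H \<longleftrightarrow> n = 2 \<or> n = p"
proof
  assume at: "replicate_mset n g \<in> atoms H"
  then have n: "even n \<or> n \<ge> p" "n \<noteq> 0"
    using replicate_mem_iff[OF g] atom_mem atom_nonempty by force+
  have no: "\<not> (k < n \<and> k > 0 \<and> replicate_mset k g \<in> zero_sums \<and> replicate_mset (n - k) g \<in> zero_sums)" for k
  proof
    assume k: "k < n \<and> k > 0 \<and> replicate_mset k g \<in> zero_sums \<and> replicate_mset (n - k) g \<in> zero_sums"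
    then have "replicate_mset n g = replicate_mset k g + replicate_mset (n - k) g"
      by (simp flip: replicate_mset_add)
    then have "replicate_mset k g = {#} \<or> replicate_mset (n - k) g = {#}"
      using atom_indecomposable[OF at] k by blast
    then show False using k by simp
  qed
  show "n = 2 \<or> n = p"
  proof (cases "even n")
    case True
    then show ?thesis
      using no[of 2] n by (auto simp: replicate_mem_iff[OF g])
  next
    case False
    then show ?thesis
      using no[of p] n odd_p p_ge_3 by (auto simp: replicate_mem_iff[OF g])
  qed
next
  assume n: "n = 2 \<or> n = p"
  have "b = {#} \<or> c = {#}"
    if bc: "b \<in> zero_sums" "c \<in> zero_sums" "replicate_mset n g = b + c" for b c
  proof -
    have "b \<subseteq># replicate_mset n g" "c \<subseteq># replicate_mset n g"
      unfolding bc(3) by simp_all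
    then obtain k l where k: "b = replicate_mset k g" and l: "c = replicate_mset l g"
      by (metis msubseteq_replicate_msetE)
    have "n = k + l"
      using bc(3) k l by (metis size_replicate_mset size_union)
    moreover have "even k \<or> k \<ge> p" "even l \<or> l \<ge> p"
      using bc(1,2) k l replicate_mem_iff[OF g] by blast+
    ultimately have "k = 0 \<or> l = 0"
      using n odd_p p_ge_3 by presburger
    then show ?thesis using k l by auto
  qed
  moreover have "replicate_mset n g \<in> zero_sums" "replicate_mset n g \<noteq> {#}"
    using n p_ge_3 by (auto simp: replicate_mem_iff[OF g])
  ultimately show "replicate_mset n g \<in> atoms H"
    by (auto simp: atoms_H)
qed

text \<open>
  A signed sum of \<open>n\<close> copies of 1 has to be congruent to \<open>a\<close> or \<open>-a\<close>. Up to sign, the least such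
  integers are \<open>a\<close> and \<open>p - a\<close>, which have different parities because \<open>p\<close> is odd. So the parity
  of \<open>n\<close> decides which of them has to be reached.
\<close>

lemma add_replicate_mem_iff:
  assumes g: "g \<in> C" "e g = 1" and h: "h \<in> C" "e h = int a" and a: "a < p"
  shows "add_mset h (replicate_mset n g) \<in> zero_sums \<longleftrightarrow>
           (if even n = even a then a \<le> n else p - a \<le> n)"
proof
  assume "add_mset h (replicate_mset n g) \<in> zero_sums"
  then obtain t where "t \<in> signed_sums e (add_mset h (replicate_mset n g))" "int p dvd t"
    by (auto simp: zero_sums_def)
  then obtain i where i: "i \<le> n" and t: "t = 2 * int i - int n + int a \<or> t = 2 * int i - int n - int a" "int p dvd t"
    using signed_sums_add_weight[where e = e and g = g and h = h, OF g(2) h(2)] by blast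
  then obtain k where k: "t = int p * k" by blast
  show "if even n = even a then a \<le> n else p - a \<le> n"
  proof (cases "n < p")
    case True
    have "\<bar>t\<bar> < 2 * int p"
      using t(1) i True a by linarith
    then have "int p * \<bar>k\<bar> < int p * 2"
      by (simp add: k abs_mult)
    then have "\<bar>k\<bar> < 2"
      by (simp add: mult_less_cancel_left)
    then have "k = 0 \<or> k = 1 \<or> k = -1"
      by linarith
    then have t': "t = 0 \<or> t = int p \<or> t = - int p"
      using k by auto
    define s where "s = 2 * int i - int n"
    have s: "even s = even n" "\<bar>s\<bar> \<le> int n"
      using i by (simp_all add: s_def)
    have "s = t - int a \<or> s = t + int a"
      using t(1) by (auto simp: s_def)
    with t' consider "s = int a" | "s = - int a" | "s = int p - int a" | "s = int p + int a"
      | "s = - int p - int a" | "s = - int p + int a"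
      by force
    then have "if even s = even a then int a \<le> \<bar>s\<bar> else int p - int a \<le> \<bar>s\<bar>"
      using odd_p a by cases simp_all
    then show ?thesis
      using s a by (simp split: if_splits)
  qed (use a in auto)
next
  assume n: "if even n = even a then a \<le> n else p - a \<le> n"
  define m where "m = (if even n = even a then a else p - a)"
  have "even (n + m)" "m \<le> n"
    using n odd_p a by (auto simp: m_def split: if_splits)
  then obtain i where i: "n + m = 2 * i" by blast
  then have s: "2 * int i - int n = int m" "i \<le> n"
    using \<open>m \<le> n\<close> by linarith+
  have "int p dvd int m + int a \<or> int p dvd int m - int a"
    using a by (simp add: m_def of_nat_diff)
  then have "\<exists>s\<in>signed_sums e (add_mset h (replicate_mset n g)). int p dvd s"
    unfolding Bex_def signed_sums_add_weight[where e = e and g = g and h = h, OF g(2) h(2)] using s by metis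
  then show "add_mset h (replicate_mset n g) \<in> zero_sums"
    using g h by (auto simp: zero_sums_def split: if_splits)
qed

text \<open>
  In a splitting of \<open>g\<^sup>n h\<close>, the part without \<open>h\<close> is a power of \<open>g\<close> with exponent below \<open>p\<close>, hence
  an even power. So the part containing \<open>h\<close> has an exponent of the parity of \<open>n\<close>, and \<open>n\<close> is the
  least such exponent.
\<close>

lemma add_replicate_atom:
  assumes g: "g \<in> C" "e g = 1" and h: "h \<in> C" "e h = int a" and a: "2 \<le> a" "a < p"
    and n: "n = a \<or> n = p - a"
  shows "add_mset h (replicate_mset n g) \<in> atoms H"
proof -
  note mem = add_replicate_mem_iff[OF g h a(2)]
  have "h \<noteq> g"
    using g h a by auto
  have one: "c = {#}"
    if bc: "b \<in> zero_sums" "c \<in> zero_sums" "add_mset h (replicate_mset n g) = b + c" "h \<in># b" for b c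
  proof -
    obtain b' where b': "b = add_mset h b'"
      using bc(4) by (meson multi_member_split)
    then have eq: "replicate_mset n g = b' + c"
      using bc(3) by simp
    then have "b' \<subseteq># replicate_mset n g" "c \<subseteq># replicate_mset n g"
      by simp_all
    then obtain k l where k: "b' = replicate_mset k g" and l: "c = replicate_mset l g"
      by (metis msubseteq_replicate_msetE)
    have nkl: "n = k + l"
      using eq k l by (metis size_replicate_mset size_union)
    have "l < p"
      using n nkl a by auto
    then have "even l"
      using bc(2) l replicate_mem_iff[OF g] by force
    then have "even k = even n"
      using nkl by simp
    moreover have "if even k = even a then a \<le> k else p - a \<le> k"
      using bc(1) unfolding b' k mem .
    moreover have "even n \<noteq> even a" if "n = p - a"
      using that odd_p a by simp
    ultimately have "n \<le> k"
      using n by (auto split: if_splits)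
    then have "l = 0"
      using nkl by simp
    then show ?thesis using l by simp
  qed
  have "b = {#} \<or> c = {#}"
    if bc: "b \<in> zero_sums" "c \<in> zero_sums" "add_mset h (replicate_mset n g) = b + c" for b c
  proof -
    have "h \<in># b + c"
      by (simp flip: bc(3))
    then show ?thesis
      using one[of b c] one[of c b] bc by (auto simp: add.commute)
  qed
  moreover have "add_mset h (replicate_mset n g) \<in> zero_sums"
    unfolding mem using n odd_p a by auto
  ultimately show ?thesis
    by (auto simp: atoms_H)
qed

text \<open>
  Let \<open>g\<close> and \<open>h\<close> have the residues \<open>1\<close> and \<open>a\<close>. In a factorization of \<open>g\<^sup>p\<^sup>+\<^sup>a h\<close>, the atom
  containing \<open>h\<close> is \<open>g\<^sup>n h\<close> with \<open>n = a\<close> or \<open>n = p - a\<close>. In the first case an odd number \<open>p\<close> of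
  copies of \<open>g\<close> is left and forms a single atom; in the second case \<open>2 a < 2 p\<close> copies are left, and
  they fall into pairs.
\<close>

lemma length_set_two_values:
  assumes g: "g \<in> C" "e g = 1" and h: "h \<in> C" "e h = int a" and a: "2 \<le> a" "a < p"
  shows "length_set H (add_mset h (replicate_mset (p + a) g)) = {2, a + 1}" (is "length_set H ?A = _")
proof
  note mem = add_replicate_mem_iff[OF g h a(2)]
  note atom = add_replicate_atom[OF g h a]
  have rep2: "replicate_mset 2 g \<in> atoms H" and repp: "replicate_mset p g \<in> atoms H"
    by (simp_all add: replicate_atom_iff[OF g])
  have "{#add_mset h (replicate_mset a g), replicate_mset p g#} \<in> factorizations H ?A"
    using atom repp by (simp add: factorizations_H add.commute flip: replicate_mset_add)
  then have "2 \<in> length_set H ?A"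
    unfolding length_set_H by (force intro: image_eqI)
  moreover have "add_mset (add_mset h (replicate_mset (p - a) g)) (replicate_mset a (replicate_mset 2 g))
      \<in> factorizations H ?A"
    using atom rep2 a
    by (auto simp: factorizations_H sum_mset_replicate_mset mult_2_right split: if_splits simp flip: replicate_mset_add)
  then have "a + 1 \<in> length_set H ?A"
    unfolding length_set_H by (force intro: image_eqI)
  ultimately show "{2, a + 1} \<subseteq> length_set H ?A"
    by simp
  show "length_set H ?A \<subseteq> {2, a + 1}"
  proof
    fix k assume "k \<in> length_set H ?A"
    then obtain z where z: "set_mset z \<subseteq> atoms H" "\<Sum>\<^sub># z = ?A" and k: "k = size z"
      by (auto simp: length_set_H factorizations_H)
    have "h \<in># \<Sum>\<^sub># z"
      by (simp add: z(2))
    then obtain u where u: "u \<in># z" "h \<in># u"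
      by auto
    then obtain z' u' where z': "z = add_mset u z'" and u': "u = add_mset h u'"
      by (meson multi_member_split)
    then have eq: "replicate_mset (p + a) g = u' + \<Sum>\<^sub># z'"
      using z(2) by simp
    then have "u' \<subseteq># replicate_mset (p + a) g" "\<Sum>\<^sub># z' \<subseteq># replicate_mset (p + a) g"
      by simp_all
    then obtain n m where n: "u' = replicate_mset n g" and m: "\<Sum>\<^sub># z' = replicate_mset m g"
      by (metis msubseteq_replicate_msetE)
    have nm: "p + a = n + m"
      using eq n m by (metis size_replicate_mset size_union)
    have ua: "add_mset h (replicate_mset n g) \<in> atoms H"
      using z(1) z' u' n by simp
    then have un: "if even n = even a then a \<le> n else p - a \<le> n"
      using mem atom_mem by blast
    have z'_atoms: "set_mset z' \<subseteq> atoms H"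
      using z(1) z' by simp
    show "k \<in> {2, a + 1}"
    proof (cases "even n = even a")
      case True
      then have "a \<le> n" "odd m"
        using un nm odd_p by (auto simp: even_add dest: arg_cong[of _ _ even])
      then have "replicate_mset m g \<in> zero_sums"
        using sum_atoms_mem[OF z'_atoms] m by simp
      then have "m = p"
        using replicate_mem_iff[OF g] \<open>odd m\<close> \<open>a \<le> n\<close> nm by force
      obtain v z'' where v: "z' = add_mset v z''"
        using m \<open>m = p\<close> p_ge_3 by (cases z') auto
      have "replicate_mset p g = v + \<Sum>\<^sub># z''" "v \<in> zero_sums" "\<Sum>\<^sub># z'' \<in> zero_sums"
        using m v \<open>m = p\<close> z'_atoms sum_atoms_mem[of z''] by (auto intro: atom_mem)
      then have "v = {#} \<or> \<Sum>\<^sub># z'' = {#}"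
        using atom_indecomposable[OF repp] by blast
      then have "z'' = {#}"
        using z'_atoms v atom_nonempty by (cases z'') auto
      then show ?thesis
        using k z' v by simp
    next
      case False
      \<comment> \<open>Larger exponents of the same parity would allow the pair \<open>g\<^sup>2\<close> to be split off.\<close>
      have "n = p - a"
      proof (rule ccontr)
        assume "n \<noteq> p - a"
        then have big: "n \<ge> p - a + 2"
          using un False odd_p a by presburger
        then have "add_mset h (replicate_mset (n - 2) g) \<in> zero_sums"
          unfolding mem using False by auto
        moreover have "n - 2 + 2 = n"
          using big by simp
        then have "add_mset h (replicate_mset n g) = add_mset h (replicate_mset (n - 2) g) + replicate_mset 2 g"
          by (metis replicate_mset_add union_mset_add_mset_left)
        ultimately have "add_mset h (replicate_mset (n - 2) g) = {#} \<or> replicate_mset 2 g = {#}"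
          using atom_indecomposable[OF ua] atom_mem[OF rep2] by blast
        then show False by simp
      qed
      then have "m = 2 * a"
        using nm a by simp
      \<comment> \<open>An atom \<open>g\<^sup>p\<close> would leave an odd number \<open>2 a - p < p\<close> of copies of \<open>g\<close>.\<close>
      have two: "size v = 2" if v: "v \<in># z'" for v
      proof -
        obtain z'' where z'': "z' = add_mset v z''"
          using v by (meson multi_member_split)
        have sum: "replicate_mset m g = v + \<Sum>\<^sub># z''"
          using m z'' by simp
        then have "v \<subseteq># replicate_mset m g" "\<Sum>\<^sub># z'' \<subseteq># replicate_mset m g"
          by simp_all
        then obtain i j where i: "v = replicate_mset i g" and j: "\<Sum>\<^sub># z'' = replicate_mset j g"
          by (metis msubseteq_replicate_msetE)
        have "m = i + j"
          using sum i j by (metis size_replicate_mset size_union)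
        have "replicate_mset j g \<in> zero_sums"
          unfolding j[symmetric] using z'_atoms z'' by (intro sum_atoms_mem) simp
        then have "even j \<or> j \<ge> p"
          by (simp add: replicate_mem_iff[OF g])
        then have "i \<noteq> p"
          using \<open>m = i + j\<close> \<open>m = 2 * a\<close> odd_p a by presburger
        moreover have "i = 2 \<or> i = p"
          using i v z'_atoms replicate_atom_iff[OF g] by blast
        ultimately show ?thesis using i by simp
      qed
      have "size (\<Sum>\<^sub># z') = 2 * size z'"
        using two by (induction z') auto
      then have "size z' = a"
        using m \<open>m = 2 * a\<close> by simp
      then show ?thesis
        using k z' by simp
    qed
  qed
qed

lemma mem_delta_monoid:
  assumes "1 \<le> d" "d \<le> p - 2"
  shows "d \<in> delta_monoid H"
proof -
  define a where "a = d + 1"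
  have a: "2 \<le> a" "a < p"
    using assms p_ge_3 by (auto simp: a_def)
  obtain g where g: "g \<in> C" "e g = 1"
    using ex_weight[of 1] p_ge_3 by auto
  obtain h where h: "h \<in> C" "e h = int a"
    using ex_weight a by blast
  let ?A = "add_mset h (replicate_mset (p + a) g)"
  have L: "int ` length_set H ?A = {2, 2 + int d}"
    using length_set_two_values[OF g h a] by (simp add: a_def)
  have "d \<in> delta_set (int ` length_set H ?A)"
    unfolding L delta_set_def using assms(1) by auto
  moreover have "?A \<in> carrier H"
    using add_replicate_mem_iff[OF g h a(2), of "p + a"] by (simp add: le_diff_conv)
  ultimately show ?thesis
    unfolding delta_monoid_def system_of_length_sets_def by blast
qed

text \<open>
  The gap \<open>p - 2\<close> closes the circle
  \<open>p = 2 + (p - 2) \<le> c(H) \<le> \<omega>(H) \<le> p\<close> and so determines both invariants at once.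
\<close>

lemma catenary_degree_eq: "catenary_degree H = enat p"
  and omega_monoid_eq: "omega_monoid H = enat p"
proof -
  have "p - 2 \<in> delta_monoid H"
    using p_ge_3 by (intro mem_delta_monoid) auto
  then have "enat (p - 2 + 2) \<le> catenary_degree H"
    by (rule delta_le_catenary_degree)
  moreover have "p - 2 + 2 = p"
    using p_ge_3 by simp
  ultimately have "enat p \<le> catenary_degree H"
    by (simp only:)
  with catenary_degree_le_omega omega_monoid_le_p
  show "catenary_degree H = enat p" "omega_monoid H = enat p"
    by (meson antisym order_trans)+
qed

lemma delta_monoid_eq: "delta_monoid H = {1..p - 2}"
proof
  show "{1..p - 2} \<subseteq> delta_monoid H"
    using mem_delta_monoid by auto
  show "delta_monoid H \<subseteq> {1..p - 2}"
  proof
    fix d assume d: "d \<in> delta_monoid H"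
    then have "enat (d + 2) \<le> enat p"
      using delta_le_catenary_degree catenary_degree_eq by metis
    moreover have "d \<ge> 1"
      using d by (auto simp: delta_monoid_def delta_set_def)
    ultimately show "d \<in> {1..p - 2}" by auto
  qed
qed

lemma Max_size_atoms: "Max (size ` atoms H) = p"
proof (rule Max_eqI)
  have bound: "size ` atoms H \<subseteq> {..p}"
    using size_atom_le by blast
  then show "finite (size ` atoms H)"
    by (rule finite_subset) simp
  show "y \<le> p" if "y \<in> size ` atoms H" for y
    using that bound by blast
  obtain g where g: "g \<in> C" "e g = 1"
    using ex_weight[of 1] p_ge_3 by auto
  have "replicate_mset p g \<in> atoms H"
    by (simp add: replicate_atom_iff[OF g])
  then show "p \<in> size ` atoms H"
    by (metis imageI size_replicate_mset)
qed

end

section \<open>Discrete logarithms\<close>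

text \<open>
  Signs chosen position by position in a list give the same sums as splitting the multiset into
  the elements with sign 1 and those with sign -1.
\<close>

lemma signed_sums_mset:
  "signed_sums e (mset gs) =
     {(\<Sum>i<length gs. \<epsilon> i * e (gs ! i)) | \<epsilon>. \<forall>i<length gs. \<epsilon> i \<in> {1, -1}}" (is "_ = ?S gs")
proof (induction gs rule: rev_induct)
  case (snoc x gs)
  let ?n = "length gs"
  have sum_Suc: "(\<Sum>i<length (gs @ [x]). \<epsilon> i * e ((gs @ [x]) ! i)) = (\<Sum>i<?n. \<epsilon> i * e (gs ! i)) + \<epsilon> ?n * e x"
    for \<epsilon> :: "nat \<Rightarrow> int"
    by (simp add: nth_append)
  show ?case
  proof (intro equalityI subsetI)
    fix s assume "s \<in> signed_sums e (mset (gs @ [x]))"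
    then obtain t where t: "t \<in> signed_sums e (mset gs)" "s = t + e x \<or> s = t - e x"
      by (auto simp: signed_sums_add_mset)
    from t(2) have "s = t + 1 * e x \<or> s = t + (-1) * e x"
      by simp
    then obtain c :: int where c: "c \<in> {1, -1}" "s = t + c * e x"
      by blast
    from t(1) snoc obtain \<epsilon> where \<epsilon>: "\<forall>i<?n. \<epsilon> i \<in> {1, -1}" "t = (\<Sum>i<?n. \<epsilon> i * e (gs ! i))"
      by blast
    have "s = (\<Sum>i<length (gs @ [x]). (\<epsilon>(?n := c)) i * e ((gs @ [x]) ! i))"
      unfolding sum_Suc using c(2) \<epsilon>(2) by simp
    moreover have "\<forall>i<length (gs @ [x]). (\<epsilon>(?n := c)) i \<in> {1, -1}"
      using \<epsilon>(1) c(1) by (simp add: less_Suc_eq)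
    ultimately show "s \<in> ?S (gs @ [x])"
      by blast
  next
    fix s assume "s \<in> ?S (gs @ [x])"
    then obtain \<epsilon> where \<epsilon>: "\<forall>i<length (gs @ [x]). \<epsilon> i \<in> {1, -1}"
      "s = (\<Sum>i<?n. \<epsilon> i * e (gs ! i)) + \<epsilon> ?n * e x"
      unfolding sum_Suc by blast
    have "(\<Sum>i<?n. \<epsilon> i * e (gs ! i)) \<in> signed_sums e (mset gs)"
      unfolding snoc using \<epsilon>(1) by (intro CollectI exI[of _ \<epsilon>]) simp
    moreover have "\<epsilon> ?n = 1 \<or> \<epsilon> ?n = -1"
      using \<epsilon>(1) by auto
    ultimately show "s \<in> signed_sums e (mset (gs @ [x]))"
      using \<epsilon>(2) by (auto simp: signed_sums_add_mset)
  qed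
qed auto

lemma cyclic_group_discrete_log:
  fixes G (structure)
  assumes "group G" "cyclic_group G" "order G = p" "p > 0"
  obtains x e where "x \<in> carrier G" "\<And>y. y \<in> carrier G \<Longrightarrow> x [^] e y = y"
    "bij_betw e (carrier G) {0..<int p}" "\<And>n::int. x [^] n = \<one> \<longleftrightarrow> int p dvd n"
proof -
  interpret group G by fact
  obtain x where x: "x \<in> carrier G" and range: "carrier G = range (\<lambda>n::int. x [^] n)"
    using assms(2) cyclic_group by blast
  let ?f = "\<lambda>n::int. x [^] n"
  have "x [^] int p = \<one>"
    using pow_order_eq_1[OF x] assms(3) by (simp add: int_pow_int)
  then have red: "x [^] n = x [^] (n mod int p)" for n :: int
    using x by (metis int_pow_closed int_pow_mult int_pow_one int_pow_pow mult.commute mult_div_mod_eq l_one)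
  have img: "?f ` {0..<int p} = carrier G"
  proof
    show "carrier G \<subseteq> ?f ` {0..<int p}"
    proof
      fix y assume "y \<in> carrier G"
      then obtain n where "y = x [^] (n::int)"
        using range by blast
      then have "y = ?f (n mod int p)"
        using red by simp
      then show "y \<in> ?f ` {0..<int p}"
        using assms(4) by auto
    qed
  qed (use x in auto)
  have inj: "inj_on ?f {0..<int p}"
    using assms(3) by (intro eq_card_imp_inj_on) (simp_all add: img order_def)
  define e where "e = inv_into {0..<int p} ?f"
  show thesis
  proof (rule that[of x e])
    show "x [^] e y = y" if "y \<in> carrier G" for y
      using that img unfolding e_def by (intro f_inv_into_f) simp
    show "bij_betw e (carrier G) {0..<int p}"
      unfolding e_def using bij_betw_inv_into inj img by (metis bij_betw_def)
    show "x [^] n = \<one> \<longleftrightarrow> int p dvd n" for n :: int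
    proof
      assume "x [^] n = \<one>"
      then have "?f (n mod int p) = ?f 0"
        using red by simp
      then have "n mod int p = 0"
        by (rule inj_onD[OF inj]) (use assms(4) in simp_all)
      then show "int p dvd n" by auto
    next
      assume "int p dvd n"
      then show "x [^] n = \<one>"
        using red[of n] by simp
    qed
  qed (fact x)
qed

lemma finprod_int_pow:
  assumes "comm_group G" "x \<in> carrier G"
  shows "(\<Otimes>\<^bsub>G\<^esub>i\<in>{..<n::nat}. x [^]\<^bsub>G\<^esub> (f i :: int)) = x [^]\<^bsub>G\<^esub> (\<Sum>i<n. f i)"
proof -
  interpret comm_group G by fact
  show ?thesis
    using assms(2) by (induction n) (simp_all add: lessThan_Suc int_pow_mult m_comm)
qed

text \<open>
  With every group element written as a power of the generator \<open>x\<close>, a product of signed powers is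
  \<open>x\<close> to the power of a signed sum of discrete logarithms.
\<close>

lemma plus_minus_monoid_eq_zero_sums:
  assumes G: "comm_group G" and x: "x \<in> carrier G"
    and e: "\<And>y. y \<in> carrier G \<Longrightarrow> x [^]\<^bsub>G\<^esub> e y = y"
    and one: "\<And>n::int. x [^]\<^bsub>G\<^esub> n = \<one>\<^bsub>G\<^esub> \<longleftrightarrow> int p dvd n"
  shows "plus_minus_monoid G =
    \<lparr>carrier = {S. set_mset S \<subseteq> carrier G \<and> (\<exists>s\<in>signed_sums e S. int p dvd s)},
     monoid.mult = (+), one = {#}\<rparr>"
proof -
  interpret comm_group G by fact
  have pow: "(\<Otimes>\<^bsub>G\<^esub>i\<in>{..<length gs}. (gs ! i) [^]\<^bsub>G\<^esub> \<epsilon> i) = x [^]\<^bsub>G\<^esub> (\<Sum>i<length gs. \<epsilon> i * e (gs ! i))"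
    if "set gs \<subseteq> carrier G" for gs and \<epsilon> :: "nat \<Rightarrow> int"
  proof -
    have "(gs ! i) [^]\<^bsub>G\<^esub> \<epsilon> i = x [^]\<^bsub>G\<^esub> (\<epsilon> i * e (gs ! i))" if "i < length gs" for i
    proof -
      have "gs ! i \<in> carrier G"
        using that \<open>set gs \<subseteq> carrier G\<close> by (meson nth_mem subsetD)
      then show ?thesis
        using e x by (metis int_pow_pow mult.commute)
    qed
    then have "(\<Otimes>\<^bsub>G\<^esub>i\<in>{..<length gs}. (gs ! i) [^]\<^bsub>G\<^esub> \<epsilon> i)
        = (\<Otimes>\<^bsub>G\<^esub>i\<in>{..<length gs}. x [^]\<^bsub>G\<^esub> (\<epsilon> i * e (gs ! i)))"
      using x by (intro finprod_cong') auto
    then show ?thesis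
      by (simp only: finprod_int_pow[OF G x])
  qed
  have iff: "(\<exists>\<epsilon> :: nat \<Rightarrow> int. (\<forall>i<length gs. \<epsilon> i \<in> {1, -1}) \<and>
          (\<Otimes>\<^bsub>G\<^esub>i\<in>{..<length gs}. (gs ! i) [^]\<^bsub>G\<^esub> \<epsilon> i) = \<one>\<^bsub>G\<^esub>)
     \<longleftrightarrow> (\<exists>s\<in>signed_sums e (mset gs). int p dvd s)" if "set gs \<subseteq> carrier G" for gs
    unfolding pow[OF that] one signed_sums_mset by blast
  have "{mset gs | gs. set gs \<subseteq> carrier G \<and>
       (\<exists>\<epsilon> :: nat \<Rightarrow> int. (\<forall>i<length gs. \<epsilon> i \<in> {1, -1}) \<and>
          (\<Otimes>\<^bsub>G\<^esub>i\<in>{..<length gs}. (gs ! i) [^]\<^bsub>G\<^esub> \<epsilon> i) = \<one>\<^bsub>G\<^esub>)}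
     = {S. set_mset S \<subseteq> carrier G \<and> (\<exists>s\<in>signed_sums e S. int p dvd s)}" (is "?L = ?R")
  proof (intro equalityI subsetI)
    fix S assume "S \<in> ?L"
    then show "S \<in> ?R"
      using iff by auto
  next
    fix S assume S: "S \<in> ?R"
    obtain gs where gs: "S = mset gs"
      using ex_mset by metis
    have sub: "set gs \<subseteq> carrier G"
      using S gs by simp
    show "S \<in> ?L"
      unfolding mem_Collect_eq using S gs sub iff[OF sub] by blast
  qed
  then show ?thesis
    unfolding plus_minus_monoid_def by simp
qed

theorem theorem6p5:
  fixes G :: "('a, 'b) monoid_scheme" and p :: nat
  assumes "group G" and "cyclic_group G"
    and "order G = p" and "Factorial_Ring.prime p" and "p \<ge> 3"
  shows "delta_monoid (plus_minus_monoid G) = {1..p - 2} \<and>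
    enat (2 + Max (delta_monoid (plus_minus_monoid G))) = catenary_degree (plus_minus_monoid G) \<and>
    catenary_degree (plus_minus_monoid G) = omega_monoid (plus_minus_monoid G) \<and>
    omega_monoid (plus_minus_monoid G) = enat (plus_minus_Davenport G)"
proof -
  interpret group G by fact
  have "p > 0"
    using assms(5) by simp
  then obtain x e where x: "x \<in> carrier G" and e: "\<And>y. y \<in> carrier G \<Longrightarrow> x [^]\<^bsub>G\<^esub> e y = y"
    and bij: "bij_betw e (carrier G) {0..<int p}"
    and one: "\<And>n::int. x [^]\<^bsub>G\<^esub> n = \<one>\<^bsub>G\<^esub> \<longleftrightarrow> int p dvd n"
    using cyclic_group_discrete_log[OF assms(1-3)] by metis
  interpret prime_residues p "carrier G" e
    by unfold_locales (fact assms(4) assms(5) bij)+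
  have "comm_group G"
    using assms(2) by (rule cyclic_imp_abelian_group)
  then have eq: "plus_minus_monoid G = H"
    using plus_minus_monoid_eq_zero_sums[OF _ x e one] by (simp add: zero_sums_def)
  have "Max {1..p - 2} = p - 2"
    using assms(5) by (intro Max_eqI) auto
  then show ?thesis
    unfolding plus_minus_Davenport_def eq delta_monoid_eq catenary_degree_eq omega_monoid_eq Max_size_atoms
    using assms(5) by simp
qed

end
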